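(* Let $G=(V,E)$ be an $n$-node, $3$ edge-connected graph of diameter $D$, with a designated source $s\in V$ holding a message $m_0$, and suppose at most one edge of $G$ is adversarial. There exists a deterministic algorithm in the adversarial \textsc{CONGEST} model that solves the adversarial broadcast task within $\widetilde{O}(D^2)$ rounds, where the nodes are not given $D$ (nor any estimate of it). In addition, at the end of the algorithm, all nodes also compute a linear estimate of the diameter $D$ of the graph.
   Context: Adversarial CONGEST model: the network is an $n$-node graph $G=(V,E)$ with a processor at each node; nodes have unique $O(\log n)$-bit identifiers; initially each node knows only the identifiers of its incident edges and a polynomial estimate of $n$ (nodes do not know the topology or the diameter). Communication proceeds in synchronous rounds in which each node may send an $O(\log n)$-bit message on each incident edge. A computationally unbounded adversary controls a fixed set $F\subseteq E$ of at most $t$ edges (here $t=1$), unknown to the nodes (nodes know the bound $t$). The adversary knows the topology, the protocol and the nodes' random coins, and is adaptive: in each round it may send arbitrary $O(\log n)$-bit messages over each edge of $F$ (possibly different in each direction), chosen based on all messages exchanged in the whole network so far. Adversarial broadcast task: given a $(2t+1)$ edge-connected graph and a source $s$ holding $m_0$, all nodes must output $m_0$ (ignoring all other messages). $\widetilde{O}(\cdot)$ hides factors polylogarithmic in $n$. *)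

theory Defs
  imports Complex_Main
begin

section \<open>Finite simple graphs\<close>

text \<open>Nodes are identified with their unique identifiers, which are natural numbers; an edge is the
  unordered pair of its endpoints' identifiers.\<close>

definition simple_graph :: "nat set \<Rightarrow> nat set set \<Rightarrow> bool" where
  "simple_graph V E \<longleftrightarrow>
     finite V \<and> V \<noteq> {} \<and> (\<forall>e\<in>E. \<exists>u\<in>V. \<exists>v\<in>V. u \<noteq> v \<and> e = {u, v})"

definition adj :: "nat set set \<Rightarrow> (nat \<times> nat) set" where
  "adj E = {(u, v). {u, v} \<in> E}"

definition connected_graph :: "nat set \<Rightarrow> nat set set \<Rightarrow> bool" where
  "connected_graph V E \<longleftrightarrow> (\<forall>u\<in>V. \<forall>v\<in>V. (u, v) \<in> (adj E)\<^sup>*)"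

definition edge_connected :: "nat \<Rightarrow> nat set \<Rightarrow> nat set set \<Rightarrow> bool" where
  "edge_connected k V E \<longleftrightarrow> (\<forall>X\<subseteq>E. card X < k \<longrightarrow> connected_graph V (E - X))"

definition graph_dist :: "nat set set \<Rightarrow> nat \<Rightarrow> nat \<Rightarrow> nat" where
  "graph_dist E u v = (LEAST k. (u, v) \<in> adj E ^^ k)"

definition graph_diameter :: "nat set \<Rightarrow> nat set set \<Rightarrow> nat" where
  "graph_diameter V E = Max {graph_dist E u v | u v. u \<in> V \<and> v \<in> V}"


section \<open>The adversarial CONGEST model\<close>

type_synonym msg = "bool list"

text \<open>\<open>x u v\<close> is the message travelling from \<open>u\<close> to \<open>v\<close> in one round; \<open>None\<close> is silence.\<close>
type_synonym traffic = "nat \<Rightarrow> nat \<Rightarrow> msg option"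

text \<open>What one node receives in one round, indexed by the neighbour at the other end of the edge.\<close>
type_synonym inbox = "nat \<Rightarrow> msg option"

record network =
  nodes :: "nat set"
  edges :: "nat set set"
  source :: nat
  source_msg :: msg
  estimate :: nat

text \<open>Everything a node knows before the first round. The last component is \<open>Some m\<close> at the source
  and \<open>None\<close> elsewhere; the other nodes do not know which node is the source.\<close>
record local_input =
  own_id :: nat
  incident_edges :: "nat set set"
  size_estimate :: nat
  held_msg :: "msg option"

definition local_input_of :: "network \<Rightarrow> nat \<Rightarrow> local_input" where
  "local_input_of G v =
     \<lparr> own_id = v,
       incident_edges = {e \<in> edges G. v \<in> e},
       size_estimate = estimate G,
       held_msg = (if v = source G then Some (source_msg G) else None) \<rparr>"

text \<open>A deterministic protocol, in full-information form: what a node does is a function of its local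
  input and of the list of inboxes it has received so far (oldest first). \<open>send i w v\<close> is the message
  to the neighbour \<open>v\<close>. A node terminates as soon as \<open>result\<close> is not \<open>None\<close>.\<close>
record 'o protocol =
  send :: "local_input \<Rightarrow> inbox list \<Rightarrow> nat \<Rightarrow> msg option"
  result :: "local_input \<Rightarrow> inbox list \<Rightarrow> 'o option"

text \<open>An adversary strategy sees, for all past rounds (oldest first), the messages handed to the edges
  and the messages actually delivered, and also the messages the nodes send in the current round.
  Only its values on the controlled edges are used. Knowledge of the topology and of the
  protocol is expressed by choosing the strategy after them.\<close>
type_synonym adversary = "(traffic \<times> traffic) list \<Rightarrow> traffic \<Rightarrow> traffic"

record config =
  views :: "nat \<Rightarrow> inbox list"
  history :: "(traffic \<times> traffic) list"

text \<open>A terminated node sends nothing.\<close>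
definition sent :: "'o protocol \<Rightarrow> network \<Rightarrow> config \<Rightarrow> traffic" where
  "sent P G c = (\<lambda>u v.
     if {u, v} \<in> edges G \<and> result P (local_input_of G u) (views c u) = None
     then send P (local_input_of G u) (views c u) v else None)"

definition delivered ::
  "'o protocol \<Rightarrow> network \<Rightarrow> nat set set \<Rightarrow> adversary \<Rightarrow> config \<Rightarrow> traffic" where
  "delivered P G F A c = (\<lambda>u v.
     if {u, v} \<in> F then A (history c) (sent P G c) u v else sent P G c u v)"

text \<open>The view of a terminated node is frozen, so its output never changes.\<close>
definition round_step ::
  "'o protocol \<Rightarrow> network \<Rightarrow> nat set set \<Rightarrow> adversary \<Rightarrow> config \<Rightarrow> config" where
  "round_step P G F A c =
     \<lparr> views = (\<lambda>v. if result P (local_input_of G v) (views c v) = None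
                    then views c v @ [\<lambda>u. delivered P G F A c u v] else views c v),
       history = history c @ [(sent P G c, delivered P G F A c)] \<rparr>"

definition config_after ::
  "'o protocol \<Rightarrow> network \<Rightarrow> nat set set \<Rightarrow> adversary \<Rightarrow> nat \<Rightarrow> config" where
  "config_after P G F A r = (round_step P G F A ^^ r) \<lparr> views = (\<lambda>_. []), history = [] \<rparr>"

definition output_after ::
  "'o protocol \<Rightarrow> network \<Rightarrow> nat set set \<Rightarrow> adversary \<Rightarrow> nat \<Rightarrow> nat \<Rightarrow> 'o option" where
  "output_after P G F A r v = result P (local_input_of G v) (views (config_after P G F A r) v)"

definition traffic_bounded :: "real \<Rightarrow> traffic \<Rightarrow> bool" where
  "traffic_bounded b x \<longleftrightarrow> (\<forall>u v m. x u v = Some m \<longrightarrow> real (length m) \<le> b)"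

abbreviation log_size :: "network \<Rightarrow> real" where
  "log_size G \<equiv> log 2 (real (card (nodes G)))"

text \<open>The constants \<open>a\<close>, \<open>b\<close>, \<open>c\<close> are those implicit in ``\<open>O(log n)\<close>-bit identifiers'',
  ``polynomial estimate of \<open>n\<close>'' (which may lie above or below \<open>n\<close>) and ``\<open>O(log n)\<close>-bit message
  \<open>m\<^sub>0\<close>''.\<close>
definition valid_network :: "nat \<Rightarrow> nat \<Rightarrow> nat \<Rightarrow> network \<Rightarrow> bool" where
  "valid_network a b c G \<longleftrightarrow>
     simple_graph (nodes G) (edges G) \<and> source G \<in> nodes G \<and>
     (\<forall>v\<in>nodes G. v < card (nodes G) ^ a) \<and>
     estimate G \<le> card (nodes G) ^ b \<and> card (nodes G) \<le> estimate G ^ b \<and>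
     real (length (source_msg G)) \<le> real c * log_size G"

text \<open>An adversary controlling at most \<open>t\<close> edges of bandwidth \<open>\<beta> log n\<close>.\<close>
definition valid_adversary ::
  "nat \<Rightarrow> real \<Rightarrow> network \<Rightarrow> nat set set \<Rightarrow> adversary \<Rightarrow> bool" where
  "valid_adversary t \<beta> G F A \<longleftrightarrow>
     F \<subseteq> edges G \<and> card F \<le> t \<and> (\<forall>h x. traffic_bounded (\<beta> * log_size G) (A h x))"

end

theory Submission
  imports Defs "HOL-Library.Nat_Bijection"
begin

text \<open>Everything is reduced to reliably flooding a token that has no content: some set of nodes starts
  it, and a node must either become certain that it was really started or stay uncertain. Each node
  keeps a set of suspects, edges one of which must be faulty if the token is fake: all edges at
  first, and none at a starter. Neighbours exchange these sets, and a node that receives the set \<open>S\<close>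
  over the edge \<open>e\<close> intersects its own with \<open>insert e S\<close>. The faulty edge is thereby never cleared by
  a fake token, while any \<open>f\<close> is cleared along every walk from a starter that avoids both \<open>f\<close> and the
  faulty edge. A node is certain once its set is empty. Since \<open>R\<close> exchanges of sets of at most \<open>R\<close>
  edges suffice for walks of length \<open>R\<close>, this costs about \<open>R\<^sup>2\<close> bits per edge, sent one per round.

  For the guesses \<open>2 ^ g\<close> of the diameter, the source floods, for each bit of the padded message, the
  token saying that it is 1 or the one saying that it is 0. Then the nodes that did not learn
  all bits flood an alarm, and if the source does not become certain of the alarm, it floods a
  permission to stop. In a 3-edge-connected graph, if all nodes outside \<open>U\<close> are within distance
  \<open>R\<close> of the source, then deleting any two edges leaves a walk of length \<open>10 * R + 5\<close> to \<open>U\<close>. So the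
  alarm always reaches the source, the permission reaches everybody, and a guess that is at least the
  diameter succeeds.\<close>

section \<open>Walks avoiding few edges\<close>

lemma adj_relpow_sym:
  assumes "(x, y) \<in> adj E ^^ k"
  shows "(y, x) \<in> adj E ^^ k"
  using assms
proof (induction k arbitrary: y)
  case (Suc k)
  then obtain z where z: "(x, z) \<in> adj E ^^ k" "(z, y) \<in> adj E" by auto
  then have "(y, z) \<in> adj E" by (simp add: adj_def insert_commute)
  then show ?case using Suc.IH[OF z(1)] by (rule relpow_Suc_I2)
qed simp

lemma adj_in_nodes:
  assumes "simple_graph V E" "(x, y) \<in> adj E"
  shows "x \<in> V" "y \<in> V"
  using assms by (fastforce simp: simple_graph_def adj_def doubleton_eq_iff)+

lemma relpow_in_nodes:
  assumes "simple_graph V E" "x \<in> V" "(x, y) \<in> adj E ^^ k"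
  shows "y \<in> V"
  using assms by (cases k) (auto dest: adj_in_nodes)

lemma adj_relpow_mono: "E \<subseteq> E' \<Longrightarrow> (x, y) \<in> adj E ^^ k \<Longrightarrow> (x, y) \<in> adj E' ^^ k"
  by (induction k arbitrary: y) (auto simp: adj_def)

text \<open>Only the part of the walk after its last use of an edge of \<open>X\<close> is kept; it
  starts at an endpoint of that edge, or at \<open>x\<close> if the walk avoids
  \<open>X\<close>.\<close>

lemma walk_suffix_avoiding:
  assumes "(x, v) \<in> adj E ^^ j"
  shows "\<exists>c\<in>insert x (\<Union>X). \<exists>i\<le>j. (c, v) \<in> adj (E - X) ^^ i"
  using assms
proof (induction j arbitrary: v)
  case (Suc j)
  then obtain u where u: "(x, u) \<in> adj E ^^ j" "(u, v) \<in> adj E" by auto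
  show ?case
  proof (cases "{u, v} \<in> X")
    case True
    then show ?thesis by (intro bexI[of _ v] exI[of _ 0]) auto
  next
    case False
    with u(2) have "(u, v) \<in> adj (E - X)" by (auto simp: adj_def)
    moreover obtain c i where "c \<in> insert x (\<Union>X)" "i \<le> j" "(c, u) \<in> adj (E - X) ^^ i"
      using Suc.IH[OF u(1)] by blast
    ultimately show ?thesis by (intro bexI[of _ c] exI[of _ "Suc i"]) auto
  qed
qed auto

text \<open>A shortest walk to \<open>U\<close> in \<open>E - X\<close> is a geodesic whose nodes all lie near \<open>s\<close> or near an endpoint
  of \<open>X\<close>, and a geodesic meets each of these at most five balls in at most \<open>2 * R + 1\<close> nodes.\<close>
lemma short_walk_avoiding:
  assumes G: "simple_graph V E" "edge_connected 3 V E"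
    and X: "X \<subseteq> E" "card X \<le> 2"
    and U: "U \<subseteq> V" "U \<noteq> {}" and s: "s \<in> V"
    and near: "\<And>v. v \<in> V - U \<Longrightarrow> \<exists>j\<le>R. (s, v) \<in> adj E ^^ j"
  shows "\<exists>u\<in>U. \<exists>j\<le>10 * R + 5. (s, u) \<in> adj (E - X) ^^ j"
proof -
  define J where "J = adj (E - X)"
  have EV: "E \<subseteq> Pow V" using G(1) by (auto simp: simple_graph_def)
  have finE: "finite E"
    using finite_subset[OF EV] G(1) by (simp add: simple_graph_def)
  have "connected_graph V (E - X)" using G(2) X by (simp add: edge_connected_def)
  then have "\<exists>k. \<exists>u\<in>U. (s, u) \<in> J ^^ k"
    using U s unfolding connected_graph_def J_def by (meson all_not_in_conv rtrancl_imp_relpow subsetD)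
  define k where "k = (LEAST k. \<exists>u\<in>U. (s, u) \<in> J ^^ k)"
  have "\<exists>u\<in>U. (s, u) \<in> J ^^ k"
    unfolding k_def by (rule LeastI_ex) fact
  then obtain u where u: "u \<in> U" "(s, u) \<in> J ^^ k" by blast
  have least: "k \<le> j" if "u' \<in> U" "(s, u') \<in> J ^^ j" for u' j
    unfolding k_def using that by (intro Least_le) blast
  obtain f where f: "f 0 = s" "f k = u" "\<And>i. i < k \<Longrightarrow> (f i, f (Suc i)) \<in> J"
    using u(2) unfolding relpow_fun_conv by blast
  have seg: "(f i, f (i + l)) \<in> J ^^ l" if "i + l \<le> k" for i l
    using that by (induction l) (auto intro: relcompI[OF _ f(3)])
  have pre: "(s, f i) \<in> J ^^ i" if "i \<le> k" for i
    using seg[of 0 i] that f(1) by simp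
  have "\<exists>c\<in>insert s (\<Union>X). \<exists>j\<le>R. (c, f i) \<in> J ^^ j" if "i < k" for i
  proof -
    have "(s, f i) \<in> adj E ^^ i"
      using pre[of i] that adj_relpow_mono[of "E - X" E] by (auto simp: J_def)
    then have "f i \<in> V" using relpow_in_nodes[OF G(1) s] by blast
    \<comment> \<open>By minimality of \<open>k\<close> the walk does not meet \<open>U\<close>
      before its end, so \<open>near\<close> applies.\<close>
    moreover have "f i \<notin> U" using least[of "f i" i] pre[of i] that by auto
    ultimately obtain j where "j \<le> R" "(s, f i) \<in> adj E ^^ j" using near by blast
    with walk_suffix_avoiding[OF this(2), of X] show ?thesis
      unfolding J_def by (meson order_trans)
  qed
  then obtain c where c: "\<And>i. i < k \<Longrightarrow> c i \<in> insert s (\<Union>X)"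
    "\<And>i. i < k \<Longrightarrow> \<exists>j\<le>R. (c i, f i) \<in> J ^^ j" by metis
  \<comment> \<open>Nodes of the walk in the ball around the same centre are joined through it by at
    most \<open>2 * R\<close> steps; were they further apart along the geodesic, this would be a
    shortcut.\<close>
  have close: "i' \<le> i + 2 * R" if le: "i < k" "i' < k" "c i = c i'" for i i'
  proof (rule ccontr)
    assume far: "\<not> i' \<le> i + 2 * R"
    obtain j j' where j: "j \<le> R" "(c i, f i) \<in> J ^^ j" "j' \<le> R" "(c i, f i') \<in> J ^^ j'"
      using c(2)[OF le(1)] c(2)[OF le(2)] le(3) by auto
    have "(f i, c i) \<in> J ^^ j" using j(2) adj_relpow_sym unfolding J_def by blast
    then have "(s, u) \<in> J ^^ i O J ^^ j O J ^^ j' O J ^^ (k - i')"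
      using pre[of i] j(4) seg[of i' "k - i'"] f(2) le by auto
    then have "(s, u) \<in> J ^^ (i + j + j' + (k - i'))"
      by (simp add: relpow_add O_assoc)
    then have "k \<le> i + j + j' + (k - i')" using least u(1) by blast
    with j(1,3) far le(2) show False by linarith
  qed
  have "\<Union>X \<subseteq> V" using X(1) EV by blast
  then have finC: "finite (insert s (\<Union>X))"
    using G(1) finite_subset[of "\<Union>X" V] by (simp add: simple_graph_def)
  have card2: "card e = 2" if "e \<in> X" for e
  proof -
    have "e \<in> E" using that X(1) by blast
    then obtain u v where "u \<noteq> v" "e = {u, v}" using G(1) unfolding simple_graph_def by meson
    then show ?thesis by simp
  qed
  have "card (\<Union>X) \<le> sum card X" by (rule card_Union_le_sum_card)
  also have "\<dots> = 2 * card X" using card2 by simp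
  finally have "card (\<Union>X) \<le> 4" using X(2) by simp
  then have cardC: "card (insert s (\<Union>X)) \<le> 5"
    using card_insert_le_m1[of 5 "\<Union>X" s] by simp
  have small: "card {i. i < k \<and> c i = x} \<le> 2 * R + 1" (is "card ?S \<le> _") for x
  proof (cases "?S = {}")
    case False
    then have m: "Min ?S \<in> ?S" by (intro Min_in) auto
    have "?S \<subseteq> {Min ?S..Min ?S + 2 * R}"
      using close m by auto
    from card_mono[OF _ this] show ?thesis by simp
  next
    case True
    then show ?thesis by (metis card.empty le0)
  qed
  have "{..<k} = (\<Union>x\<in>insert s (\<Union>X). {i. i < k \<and> c i = x})"
    using c(1) by auto
  then have "k = card (\<Union>x\<in>insert s (\<Union>X). {i. i < k \<and> c i = x})" by (metis card_lessThan)
  also have "\<dots> \<le> (\<Sum>x\<in>insert s (\<Union>X). card {i. i < k \<and> c i = x})"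
    by (rule card_UN_le[OF finC])
  also have "\<dots> \<le> card (insert s (\<Union>X)) * (2 * R + 1)"
    using sum_bounded_above[of "insert s (\<Union>X)", OF small] by simp
  also have "\<dots> \<le> 5 * (2 * R + 1)" using cardC by (intro mult_right_mono) auto
  finally show ?thesis using u unfolding J_def by (intro bexI[of _ u] exI[of _ k]) auto
qed

section \<open>Suspect sets\<close>

definition edge_code :: "nat \<Rightarrow> nat \<Rightarrow> nat" where
  "edge_code u v = Suc (prod_encode (min u v, max u v))"

lemma edge_code_eq_iff: "edge_code u v = edge_code x y \<longleftrightarrow> {u, v} = {x, y}"
  by (auto simp: edge_code_def prod_encode_eq doubleton_eq_iff min_def max_def split: if_splits)

text \<open>The pairing function grows quadratically, so a code needs twice as many bits as an
  identifier, up to a constant.\<close>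

lemma edge_code_less:
  assumes "u < 2 ^ k" "v < 2 ^ k"
  shows "edge_code u v < 2 ^ (2 * k + 3)"
proof -
  define x where "x = (2::nat) ^ k"
  have "triangle t \<le> t * t" for t by (induction t) (auto simp: algebra_simps)
  moreover have "min u v + max u v = u + v" by (simp add: min_def max_def)
  ultimately have "edge_code u v \<le> Suc ((u + v) * (u + v) + min u v)"
    by (simp add: edge_code_def prod_encode_def)
  also have "\<dots> \<le> Suc ((2 * x) * (2 * x) + x * x)"
  proof -
    have "u + v \<le> 2 * x" "min u v \<le> x * x"
      using assms unfolding x_def by (auto intro: order_trans[OF _ le_square])
    then show ?thesis by (intro Suc_leI le_imp_less_Suc add_mono mult_le_mono) auto
  qed
  also have "\<dots> < 8 * (x * x)"
  proof -
    have "1 \<le> x * x" by (simp add: x_def)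
    moreover have "(2 * x) * (2 * x) = 4 * (x * x)" by simp
    ultimately show ?thesis by linarith
  qed
  also have "\<dots> = 2 ^ (2 * k + 3)" unfolding x_def power_add mult_2 by simp
  finally show ?thesis .
qed

text \<open>Codes are positive, so that the word 0 can serve as padding.\<close>
definition suspect_bit :: "nat \<Rightarrow> nat set \<Rightarrow> nat \<Rightarrow> bool" where
  "suspect_bit w S p \<longleftrightarrow> finite S \<and>
     (p = 0 \<or> (p - 1) div w < card S \<and> bit (sorted_list_of_set S ! ((p - 1) div w)) ((p - 1) mod w))"

text \<open>Bit 0 tells a finite set from \<open>UNIV\<close>; then follow \<open>R\<close> words of
  \<open>w\<close> bits, least significant bit first. Every bit pattern decodes to some set, so
  faulty messages need no separate case.\<close>

definition suspects_of :: "nat \<Rightarrow> nat \<Rightarrow> (nat \<Rightarrow> bool) \<Rightarrow> nat set" where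
  "suspects_of w R y =
     (if y 0 then (\<lambda>j. horner_sum of_bool 2 (map (\<lambda>t. y (Suc (j * w + t))) [0..<w])) ` {..<R} - {0}
      else UNIV)"

lemma suspects_of_suspect_bit:
  assumes "finite S" "card S \<le> R" "S \<subseteq> {0<..<2 ^ w}"
    and y: "\<And>p. p < Suc (R * w) \<Longrightarrow> y p = suspect_bit w S p"
  shows "suspects_of w R y = S"
proof -
  let ?x = "\<lambda>j. horner_sum of_bool 2 (map (\<lambda>t. y (Suc (j * w + t))) [0..<w]) :: nat"
  let ?xs = "sorted_list_of_set S"
  have x: "?x j = (if j < card S then ?xs ! j else 0)" if "j < R" for j
  proof -
    have "y (Suc (j * w + t)) = bit (if j < card S then ?xs ! j else 0) t" if "t < w" for t
    proof -
      have "j * w + t < Suc j * w" using that by simp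
      also have "\<dots> \<le> R * w" using \<open>j < R\<close> by (intro mult_le_mono1) simp
      finally show ?thesis using that assms(1) by (simp add: y suspect_bit_def)
    qed
    then have "?x j = horner_sum of_bool 2 (map (bit (if j < card S then ?xs ! j else 0)) [0..<w])"
      by (intro arg_cong[of _ _ "horner_sum of_bool 2"] map_cong) auto
    also have "\<dots> = take_bit w (if j < card S then ?xs ! j else 0)"
      by (rule horner_sum_bit_eq_take_bit)
    also have "\<dots> = (if j < card S then ?xs ! j else 0)"
    proof -
      have "?xs ! j \<in> S" if "j < card S"
        using that assms(1) by (metis length_sorted_list_of_set nth_mem set_sorted_list_of_set)
      then show ?thesis using assms(3) by (auto simp: take_bit_nat_eq_self_iff)
    qed
    finally show ?thesis .
  qed
  have "?x ` {..<R} - {0} = S"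
  proof (intro equalityI subsetI)
    fix z assume "z \<in> ?x ` {..<R} - {0}"
    then obtain j where "z = ?xs ! j" "j < card S" by (auto simp: x split: if_splits)
    then show "z \<in> S"
      using assms(1) by (metis length_sorted_list_of_set nth_mem set_sorted_list_of_set)
  next
    fix z assume z: "z \<in> S"
    then obtain j where "j < card S" "z = ?xs ! j"
      using assms(1) by (metis in_set_conv_nth length_sorted_list_of_set set_sorted_list_of_set)
    then show "z \<in> ?x ` {..<R} - {0}"
      using z assms(2,3) by (auto simp: x image_iff intro!: bexI[of _ j])
  qed
  then show ?thesis using y[of 0] assms(1) by (simp add: suspects_of_def suspect_bit_def)
qed

section \<open>The invariant of the suspect sets\<close>

text \<open>\<open>UNIV\<close> stands for silence. The cap \<open>i\<close> holds for every honest set in round \<open>i\<close>, so it only cuts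
  off injected ones, which would otherwise outgrow the message length on their way.\<close>
definition heard :: "nat \<Rightarrow> nat \<Rightarrow> nat \<Rightarrow> nat set \<Rightarrow> nat set" where
  "heard i v u S = (if finite S \<and> card S \<le> i then insert (edge_code v u) S else UNIV)"

text \<open>Walks in this relation clear \<open>f\<close>. Here \<open>f\<close> ranges over all
  numbers, not only codes, because a non-starter begins with \<open>UNIV\<close> and has to end with
  the empty set.\<close>

definition safe_adj :: "nat set set \<Rightarrow> nat set set \<Rightarrow> nat \<Rightarrow> (nat \<times> nat) set" where
  "safe_adj E F f = adj (E - F - {{u, v} | u v. edge_code u v = f})"

text \<open>The second conjunct also bounds distances: being certain implies being near a starter.\<close>
definition suspect_inv ::
  "nat \<Rightarrow> nat set \<Rightarrow> nat set set \<Rightarrow> nat set set \<Rightarrow> nat \<Rightarrow> (nat \<Rightarrow> bool) \<Rightarrow> nat \<Rightarrow> (nat \<Rightarrow> nat set) \<Rightarrow> bool"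
where
  "suspect_inv w V E F bad X i K \<longleftrightarrow> (\<forall>v\<in>V.
     (K v = UNIV \<or> finite (K v) \<and> card (K v) \<le> i \<and> K v \<subseteq> {0<..<2 ^ w}) \<and>
     (bad \<notin> K v \<longrightarrow> (\<exists>x\<in>V. X x \<and> (\<exists>j\<le>i. (x, v) \<in> adj E ^^ j))) \<and>
     (\<forall>f. \<forall>x\<in>V. X x \<longrightarrow> (\<forall>j\<le>i. (x, v) \<in> safe_adj E F f ^^ j \<longrightarrow> f \<notin> K v)))"

lemma suspect_inv_0:
  "suspect_inv w V E F bad X 0 (\<lambda>v. if X v then {} else UNIV)"
  by (auto simp: suspect_inv_def)

text \<open>The bits are arbitrary, so the bound also covers sets injected by the adversary.\<close>

lemma suspects_of_subset: "suspects_of w R y = UNIV \<or> suspects_of w R y \<subseteq> {0<..<2 ^ w}"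
proof -
  have "horner_sum of_bool 2 (map f [0..<w]) < (2 :: nat) ^ w" for f
    using horner_sum_of_bool_2_less[of "map f [0..<w]"] by simp
  then show ?thesis by (auto simp: suspects_of_def)
qed

text \<open>Soundness: if \<open>v\<close> loses \<open>bad\<close>, some neighbour delivered a set
  without \<open>bad\<close> over an edge with another code; that edge is honest, so the claim for
  the neighbour carries over with one more step. Completeness: the last edge of a safe walk delivers
  the sender's set unchanged and adds only its own code, which is not \<open>f\<close>.\<close>

lemma suspect_inv_Suc:
  assumes G: "simple_graph V E" and bad: "\<And>u v. {u, v} \<in> F \<Longrightarrow> edge_code u v = bad"
    and codes: "\<And>u v. u \<in> V \<Longrightarrow> v \<in> V \<Longrightarrow> edge_code u v < 2 ^ w"
    and inv: "suspect_inv w V E F bad X i K"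
    and honest: "\<And>u v. {u, v} \<in> E - F \<Longrightarrow> rec v u = K u"
    and silent: "\<And>u v. {u, v} \<notin> E \<Longrightarrow> rec v u = UNIV"
    and range: "\<And>u v. rec v u = UNIV \<or> rec v u \<subseteq> {0<..<2 ^ w}"
    and FE: "F \<subseteq> E"
  shows "suspect_inv w V E F bad X (Suc i) (\<lambda>v. K v \<inter> (\<Inter>u. heard i v u (rec v u)))"
    (is "suspect_inv _ _ _ _ _ _ _ ?K'")
  unfolding suspect_inv_def
proof (intro ballI conjI allI impI)
  have inv': "K v = UNIV \<or> finite (K v) \<and> card (K v) \<le> i \<and> K v \<subseteq> {0<..<2 ^ w}"
    "bad \<notin> K v \<Longrightarrow> \<exists>x\<in>V. X x \<and> (\<exists>j\<le>i. (x, v) \<in> adj E ^^ j)"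
    "\<And>f x j. x \<in> V \<Longrightarrow> X x \<Longrightarrow> j \<le> i \<Longrightarrow> (x, v) \<in> safe_adj E F f ^^ j \<Longrightarrow> f \<notin> K v"
    if "v \<in> V" for v
    using inv that unfolding suspect_inv_def by blast+
  fix v assume v: "v \<in> V"
  show "?K' v = UNIV \<or> finite (?K' v) \<and> card (?K' v) \<le> Suc i \<and> ?K' v \<subseteq> {0<..<2 ^ w}"
  proof (cases "K v = UNIV")
    case False
    then have K: "finite (K v)" "card (K v) \<le> i" "K v \<subseteq> {0<..<2 ^ w}" using inv'(1)[OF v] by auto
    have "card (?K' v) \<le> card (K v)" by (rule card_mono) (use K in auto)
    then show ?thesis using K by auto
  next
    case True
    show ?thesis
    proof (cases "\<exists>u. heard i v u (rec v u) \<noteq> UNIV")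
      case True
      then obtain u where u: "finite (rec v u)" "card (rec v u) \<le> i"
        by (auto simp: heard_def split: if_splits)
      then have ne: "rec v u \<noteq> UNIV" using infinite_UNIV_nat by metis
      then have "{u, v} \<in> E" using silent by blast
      then have "u \<in> V" using adj_in_nodes[OF G, of u v] by (simp add: adj_def)
      then have "edge_code v u \<in> {0<..<2 ^ w}" using codes[OF v] by (simp add: edge_code_def)
      then have sub: "heard i v u (rec v u) \<subseteq> {0<..<2 ^ w}" using range[of v u] ne u
        by (simp add: heard_def)
      have h: "finite (heard i v u (rec v u))" "card (heard i v u (rec v u)) \<le> Suc i"
        using u card_insert_le_m1[of "Suc i" "rec v u"] by (auto simp: heard_def card_insert_if)
      have sub': "?K' v \<subseteq> heard i v u (rec v u)" by auto
      have "card (?K' v) \<le> Suc i"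
        using card_mono[OF h(1) sub'] h(2) by simp
      moreover have "finite (?K' v)" using finite_subset[OF sub' h(1)] .
      ultimately show ?thesis using sub sub' by blast
    next
      case False
      then show ?thesis using True by auto
    qed
  qed
  show "\<exists>x\<in>V. X x \<and> (\<exists>j\<le>Suc i. (x, v) \<in> adj E ^^ j)" if notin: "bad \<notin> ?K' v"
  proof (cases "bad \<in> K v")
    case False
    then show ?thesis using inv'(2)[OF v] le_SucI by blast
  next
    case True
    then obtain u where u: "bad \<notin> heard i v u (rec v u)" using notin by blast
    then have rec: "bad \<notin> rec v u" "bad \<noteq> edge_code v u"
      by (auto simp: heard_def split: if_splits)
    then have E: "{u, v} \<in> E" using silent by blast
    moreover have "{u, v} \<notin> F" using bad[of v u] rec(2) by (auto simp: insert_commute)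
    ultimately have "rec v u = K u" using honest by blast
    moreover have "u \<in> V" using adj_in_nodes[OF G, of u v] E by (simp add: adj_def)
    ultimately obtain x j where "x \<in> V" "X x" "j \<le> i" "(x, u) \<in> adj E ^^ j"
      using inv'(2)[of u] rec(1) by auto
    moreover have "(u, v) \<in> adj E" using E by (simp add: adj_def)
    ultimately show ?thesis by (intro bexI[of _ x] conjI exI[of _ "Suc j"]) auto
  qed
  fix f x j
  assume x: "x \<in> V" "X x" and j: "j \<le> Suc i" "(x, v) \<in> safe_adj E F f ^^ j"
  show "f \<notin> ?K' v"
  proof (cases "j = Suc i")
    case False
    then show ?thesis using inv'(3)[OF v x _ j(2)] j(1) by auto
  next
    case True
    then obtain u where u: "(x, u) \<in> safe_adj E F f ^^ i" "(u, v) \<in> safe_adj E F f"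
      using j(2) by auto
    then have E: "{u, v} \<in> E - F" "edge_code v u \<noteq> f"
      by (auto simp: safe_adj_def adj_def insert_commute)
    then have uV: "u \<in> V" using adj_in_nodes[OF G, of u v] by (simp add: adj_def)
    then have f: "f \<notin> K u" using inv'(3)[OF uV x _ u(1)] by simp
    \<comment> \<open>Lacking \<open>f\<close>, the set \<open>K u\<close> is not
      \<open>UNIV\<close>, so it has at most \<open>i\<close> elements and passes the cap.\<close>
    then have "f \<notin> heard i v u (rec v u)"
      using honest[OF E(1)] inv'(1)[OF uV] E(2) by (auto simp: heard_def)
    then show ?thesis by blast
  qed
qed

text \<open>The contract of one slot: soundness first, then completeness. In the latter, different
  \<open>f\<close> may be cleared by different starters.\<close>

definition slot_spec ::
  "nat set \<Rightarrow> nat set set \<Rightarrow> nat set set \<Rightarrow> nat \<Rightarrow> (nat \<Rightarrow> bool) \<Rightarrow> (nat \<Rightarrow> bool) \<Rightarrow> bool"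
where
  "slot_spec V E F R X cert \<longleftrightarrow> (\<forall>v\<in>V.
     (cert v \<longrightarrow> (\<exists>x\<in>V. X x \<and> (\<exists>j\<le>R. (x, v) \<in> adj E ^^ j))) \<and>
     ((\<forall>f. \<exists>x\<in>V. X x \<and> (\<exists>j\<le>R. (x, v) \<in> safe_adj E F f ^^ j)) \<longrightarrow> cert v))"

lemma slot_spec_if_suspect_inv:
  assumes "suspect_inv w V E F bad X R K"
  shows "slot_spec V E F R X (\<lambda>v. K v = {})"
  using assms unfolding suspect_inv_def slot_spec_def by (metis all_not_in_conv empty_iff)

section \<open>The protocol\<close>

text \<open>The number of slots must not depend on the message, hence the padding to
  \<open>M\<close> bits; the marker \<open>True\<close> lets \<open>unpad\<close> recover the
  length.\<close>

definition pad :: "nat \<Rightarrow> msg \<Rightarrow> bool list" where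
  "pad M m = m @ True # replicate (M - Suc (length m)) False"

definition unpad :: "bool list \<Rightarrow> msg" where
  "unpad x = rev (tl (dropWhile Not (rev x)))"

lemma unpad_pad: "unpad (pad M m) = m"
proof -
  have "dropWhile Not (replicate k False @ xs) = dropWhile Not xs" for k xs
    by (induction k) auto
  then show ?thesis by (simp add: unpad_def pad_def)
qed

lemma length_pad: "length m < M \<Longrightarrow> length (pad M m) = M"
  by (simp add: pad_def)

text \<open>A guess takes \<open>2 * M\<close> slots for the tokens of the message bits, then one for the alarm and one
  for the permission to stop. The list \<open>\<rho>\<close> records in which of the past slots the node became certain.\<close>
definition slots :: "nat \<Rightarrow> nat" where
  "slots M = 2 * M + 2"

text \<open>\<open>15\<close> and \<open>155\<close> come from \<open>10 * R + 5 \<le> 15 * R\<close> and \<open>10 * (15 * R) + 5 \<le> 155 * R\<close>.\<close>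
definition radius :: "nat \<Rightarrow> nat \<Rightarrow> nat" where
  "radius M n = (if n mod slots M < 2 * M then 15 else 155) * 2 ^ (n div slots M)"

definition slot_length :: "nat \<Rightarrow> nat \<Rightarrow> nat \<Rightarrow> nat" where
  "slot_length w M n = radius M n * Suc (radius M n * w)"

text \<open>Slot \<open>2 * p\<close> of a guess carries the token for bit \<open>p\<close> being 1,
  slot \<open>Suc (2 * p)\<close> the one for 0.\<close>

definition informed :: "nat \<Rightarrow> bool list \<Rightarrow> bool" where
  "informed M cs \<longleftrightarrow> (\<forall>p<M. cs ! (2 * p) \<or> cs ! Suc (2 * p))"

text \<open>\<open>q\<close> is the current slot within the guess and \<open>cs\<close> the record
  of the guess so far, whose entry \<open>2 * M\<close> belongs to the alarm.\<close>

definition starts :: "nat \<Rightarrow> local_input \<Rightarrow> bool list \<Rightarrow> bool" where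
  "starts M inp \<rho> =
     (let q = length \<rho> mod slots M; cs = drop (length \<rho> - q) \<rho> in
      if q < 2 * M then (case held_msg inp of None \<Rightarrow> False | Some m \<Rightarrow> pad M m ! (q div 2) = even q)
      else if q = 2 * M then \<not> informed M cs
      else held_msg inp \<noteq> None \<and> \<not> cs ! (2 * M))"

definition first_suspects :: "nat \<Rightarrow> local_input \<Rightarrow> bool list \<Rightarrow> nat set" where
  "first_suspects M inp \<rho> = (if starts M inp \<rho> then {} else UNIV)"

text \<open>In a connected graph a node without edges is alone, hence the source, and answers at
  once. Otherwise \<open>last \<rho>\<close> at the end of a guess is the permission to stop, and
  guesses are numbered from 0.\<close>

definition verdict :: "nat \<Rightarrow> local_input \<Rightarrow> bool list \<Rightarrow> (msg \<times> nat) option" where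
  "verdict M inp \<rho> =
     (if incident_edges inp = {} then Some (the (held_msg inp), 0)
      else if \<rho> \<noteq> [] \<and> length \<rho> mod slots M = 0 \<and> last \<rho> then
        (let cs = drop (length \<rho> - slots M) \<rho> in
         Some (unpad (map (\<lambda>p. cs ! (2 * p)) [0..<M]), 2 ^ (length \<rho> div slots M - 1)))
      else None)"

text \<open>The record \<open>\<rho>\<close>, the number of exchanges completed in this slot, the current suspects, and the
  inboxes of the current exchange, each holding one bit per neighbour.\<close>
type_synonym node_state = "bool list \<times> nat \<times> nat set \<times> inbox list"

text \<open>The intersection can range over all \<open>u\<close>: a non-neighbour is silent, so its
  first bit reads as false and \<open>heard\<close> yields \<open>UNIV\<close>.\<close>

definition step :: "nat \<Rightarrow> nat \<Rightarrow> local_input \<Rightarrow> node_state \<Rightarrow> inbox \<Rightarrow> node_state" where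
  "step w M inp = (\<lambda>(\<rho>, i, K, buf) inb.
     let R = radius M (length \<rho>); buf' = buf @ [inb] in
     if length buf' < Suc (R * w) then (\<rho>, i, K, buf')
     else let K' = K \<inter> (\<Inter>u. heard i (own_id inp) u
                 (suspects_of w R (\<lambda>p. p < length buf' \<and> (buf' ! p) u = Some [True]))) in
       if Suc i < R then (\<rho>, Suc i, K', [])
       else let \<rho>' = \<rho> @ [K' = {}] in (\<rho>', 0, first_suspects M inp \<rho>', []))"

definition state :: "nat \<Rightarrow> nat \<Rightarrow> local_input \<Rightarrow> inbox list \<Rightarrow> node_state" where
  "state w M inp view = foldl (step w M inp) ([], 0, first_suspects M inp [], []) view"

definition broadcast :: "(nat \<Rightarrow> nat) \<Rightarrow> (nat \<Rightarrow> nat) \<Rightarrow> (msg \<times> nat) protocol" where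
  "broadcast wd len =
     \<lparr> send = (\<lambda>inp view v.
         case state (wd (size_estimate inp)) (len (size_estimate inp)) inp view of
           (\<rho>, i, K, buf) \<Rightarrow> Some [suspect_bit (wd (size_estimate inp)) K (length buf)]),
       result = (\<lambda>inp view.
         verdict (len (size_estimate inp)) inp
           (fst (state (wd (size_estimate inp)) (len (size_estimate inp)) inp view))) \<rparr>"

section \<open>Runs of the protocol\<close>

locale broadcast_run =
  fixes wd len :: "nat \<Rightarrow> nat" and G :: network and F :: "nat set set" and A :: adversary
    and bad :: nat
  assumes graph: "simple_graph (nodes G) (edges G)" "edge_connected 3 (nodes G) (edges G)"
    and source: "source G \<in> nodes G"
    and incident: "v \<in> nodes G \<Longrightarrow> {e \<in> edges G. v \<in> e} \<noteq> {}"
    and faulty: "F \<subseteq> edges G" "card F \<le> 1" "{u, v} \<in> F \<Longrightarrow> edge_code u v = bad"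
    and codes: "u \<in> nodes G \<Longrightarrow> v \<in> nodes G \<Longrightarrow> edge_code u v < 2 ^ wd (estimate G)"
    and msg_length: "length (source_msg G) < len (estimate G)"
begin

abbreviation "V \<equiv> nodes G"
abbreviation "E \<equiv> edges G"
abbreviation "s \<equiv> source G"
abbreviation "w \<equiv> wd (estimate G)"
abbreviation "M \<equiv> len (estimate G)"
abbreviation "P \<equiv> broadcast wd len"
abbreviation "inp \<equiv> local_input_of G"
abbreviation "cfg \<equiv> config_after P G F A"

section \<open>Exchanges in lockstep\<close>

definition st :: "nat \<Rightarrow> nat \<Rightarrow> node_state" where
  "st r v = state w M (inp v) (views (cfg r) v)"

definition inb :: "nat \<Rightarrow> nat \<Rightarrow> inbox" where
  "inb r v = (\<lambda>u. delivered P G F A (cfg r) u v)"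

lemma inp_simps [simp]:
  "own_id (inp v) = v" "size_estimate (inp v) = estimate G"
  "incident_edges (inp v) = {e \<in> E. v \<in> e}"
  "held_msg (inp v) = (if v = s then Some (source_msg G) else None)"
  by (simp_all add: local_input_of_def)

lemma result_eq: "result P (inp v) (views (cfg r) v) = verdict M (inp v) (fst (st r v))"
  by (simp add: broadcast_def st_def)

lemma st_0: "st 0 v = ([], 0, first_suspects M (inp v) [], [])"
  by (simp add: st_def state_def config_after_def)

lemma st_Suc:
  assumes "verdict M (inp v) (fst (st r v)) = None"
  shows "st (Suc r) v = step w M (inp v) (st r v) (inb r v)"
proof -
  have "views (cfg (Suc r)) v = views (cfg r) v @ [inb r v]"
    using assms by (simp add: config_after_def round_step_def inb_def flip: result_eq)
  then show ?thesis by (simp add: st_def state_def)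
qed

lemma inb_silent: "{u, v} \<notin> E \<Longrightarrow> inb r v u = None"
  using faulty(1) by (auto simp: inb_def delivered_def sent_def)

lemma inb_honest:
  assumes "{u, v} \<in> E - F" "verdict M (inp u) (fst (st r u)) = None" "st r u = (\<rho>, i, K, buf)"
  shows "inb r v u = Some [suspect_bit w K (length buf)]"
proof -
  have "result P (inp u) (views (cfg r) u) = None" using assms(2) by (simp add: result_eq)
  moreover have "send P (inp u) (views (cfg r) u) v = Some [suspect_bit w K (length buf)]"
    using assms(3) by (simp add: broadcast_def st_def)
  ultimately show ?thesis using assms(1) by (simp add: inb_def delivered_def sent_def)
qed

text \<open>An exchange is complete only with its \<open>Suc (radius M n * w)\<close>-th bit; until
  then a node just buffers what arrives.\<close>

lemma bits_collected:
  assumes st: "\<And>v. v \<in> V \<Longrightarrow> st r v = (\<rho> v, i, K v, [])"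
    and alive: "\<And>v. v \<in> V \<Longrightarrow> verdict M (inp v) (\<rho> v) = None"
    and n: "\<And>v. v \<in> V \<Longrightarrow> length (\<rho> v) = n"
    and v: "v \<in> V" and t: "t \<le> radius M n * w"
  shows "st (r + t) v = (\<rho> v, i, K v, map (\<lambda>p. inb (r + p) v) [0..<t])"
  using t
proof (induction t)
  case (Suc t)
  then have IH: "st (r + t) v = (\<rho> v, i, K v, map (\<lambda>p. inb (r + p) v) [0..<t])" by simp
  then have "st (Suc (r + t)) v = step w M (inp v) (st (r + t) v) (inb (r + t) v)"
    using alive[OF v] by (intro st_Suc) simp
  then show ?case using IH Suc.prems n[OF v] by (simp add: step_def Let_def)
qed (use st[OF v] in simp)

text \<open>As all nodes are in lockstep, the bits arriving over an honest edge are those of the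
  sender's current set, which fits because \<open>i < radius M n\<close>. So decoding restores it
  and \<open>suspect_inv_Suc\<close> applies.\<close>

lemma suspects_exchanged:
  assumes st: "\<And>v. v \<in> V \<Longrightarrow> st r v = (\<rho> v, i, K v, [])"
    and alive: "\<And>v. v \<in> V \<Longrightarrow> verdict M (inp v) (\<rho> v) = None"
    and n: "\<And>v. v \<in> V \<Longrightarrow> length (\<rho> v) = n"
    and inv: "suspect_inv w V E F bad X i K" and i: "i < radius M n"
  shows "\<exists>K'. suspect_inv w V E F bad X (Suc i) K' \<and>
    (\<forall>v\<in>V. st (r + Suc (radius M n * w)) v =
       (if Suc i < radius M n then (\<rho> v, Suc i, K' v, [])
        else (\<rho> v @ [K' v = {}], 0, first_suspects M (inp v) (\<rho> v @ [K' v = {}]), [])))"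
proof -
  let ?R = "radius M n"
  let ?B = "Suc (?R * w)"
  define rec where
    "rec v u = suspects_of w ?R (\<lambda>p. p < ?B \<and> inb (r + p) v u = Some [True])" for v u
  let ?K' = "\<lambda>v. K v \<inter> (\<Inter>u. heard i v u (rec v u))"
  note bits = bits_collected[OF st alive n]
  have honest: "rec v u = K u" if uv: "{u, v} \<in> E - F" for u v
  proof -
    have u: "u \<in> V" using adj_in_nodes[OF graph(1), of u v] uv by (simp add: adj_def)
    have inb: "inb (r + p) v u = Some [suspect_bit w (K u) p]" if "p < ?B" for p
    proof -
      have "st (r + p) u = (\<rho> u, i, K u, map (\<lambda>p. inb (r + p) u) [0..<p])"
        using that by (intro bits[OF _ _ _ u]) auto
      then show ?thesis using inb_honest[OF uv, of "r + p"] alive[OF u] by simp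
    qed
    have "K u = UNIV \<or> finite (K u) \<and> card (K u) \<le> i \<and> K u \<subseteq> {0<..<2 ^ w}"
      using inv u by (simp add: suspect_inv_def)
    then show ?thesis
    proof
      assume "K u = UNIV"
      then show ?thesis using inb[of 0] by (simp add: rec_def suspects_of_def suspect_bit_def)
    next
      assume "finite (K u) \<and> card (K u) \<le> i \<and> K u \<subseteq> {0<..<2 ^ w}"
      then show ?thesis
        unfolding rec_def using i by (intro suspects_of_suspect_bit) (auto simp: inb)
    qed
  qed
  have silent: "rec v u = UNIV" if "{u, v} \<notin> E" for u v
    using inb_silent[OF that] by (simp add: rec_def suspects_of_def)
  have "suspect_inv w V E F bad X (Suc i) ?K'"
    by (rule suspect_inv_Suc[OF graph(1) faulty(3) codes inv honest silent _ faulty(1)])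
      (auto simp: rec_def suspects_of_subset)
  moreover have "st (r + ?B) v =
       (if Suc i < ?R then (\<rho> v, Suc i, ?K' v, [])
        else (\<rho> v @ [?K' v = {}], 0, first_suspects M (inp v) (\<rho> v @ [?K' v = {}]), []))"
    if v: "v \<in> V" for v
  proof -
    have *: "st (r + ?R * w) v = (\<rho> v, i, K v, map (\<lambda>p. inb (r + p) v) [0..<?R * w])"
      by (intro bits[OF _ _ _ v]) auto
    then have "st (Suc (r + ?R * w)) v = step w M (inp v) (st (r + ?R * w) v) (inb (r + ?R * w) v)"
      using alive[OF v] by (intro st_Suc) simp
    also have "\<dots> = step w M (inp v) (\<rho> v, i, K v, map (\<lambda>p. inb (r + p) v) [0..<?R * w])
        (inb (r + ?R * w) v)" by (simp only: *)
    finally have "st (r + ?B) v = \<dots>" by simp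
    moreover have "map (\<lambda>p. inb (r + p) v) [0..<?R * w] @ [inb (r + ?R * w) v] =
        map (\<lambda>p. inb (r + p) v) [0..<?B]" by simp
    moreover have "suspects_of w ?R (\<lambda>p. p < ?B \<and>
        (map (\<lambda>p. inb (r + p) v) [0..<?B] ! p) u = Some [True]) = rec v u" for u
      unfolding rec_def by (intro arg_cong[of _ _ "suspects_of w ?R"] ext) (auto simp del: upt_Suc)
    ultimately show ?thesis using n[OF v] by (simp add: step_def Let_def del: upt_Suc)
  qed
  ultimately show ?thesis by (intro exI[of _ ?K']) blast
qed

section \<open>Slots\<close>

definition boundary :: "nat \<Rightarrow> nat \<Rightarrow> (nat \<Rightarrow> bool list) \<Rightarrow> bool" where
  "boundary r n \<rho> \<longleftrightarrow>
     (\<forall>v\<in>V. length (\<rho> v) = n \<and> st r v = (\<rho> v, 0, first_suspects M (inp v) (\<rho> v), []))"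

lemma slot_run:
  assumes "boundary r n \<rho>" and alive: "\<And>v. v \<in> V \<Longrightarrow> verdict M (inp v) (\<rho> v) = None"
  shows "\<exists>cert. boundary (r + slot_length w M n) (Suc n) (\<lambda>v. \<rho> v @ [cert v]) \<and>
    slot_spec V E F (radius M n) (\<lambda>v. starts M (inp v) (\<rho> v)) cert"
proof -
  define R where "R = radius M n"
  define B where "B = Suc (R * w)"
  let ?X = "\<lambda>v. starts M (inp v) (\<rho> v)"
  have b: "length (\<rho> v) = n" "st r v = (\<rho> v, 0, first_suspects M (inp v) (\<rho> v), [])"
    if "v \<in> V" for v using assms(1) that by (auto simp: boundary_def)
  have exchange: "\<exists>K'. suspect_inv w V E F bad ?X (Suc i) K' \<and>
    (\<forall>v\<in>V. st (r + Suc i * B) v =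
       (if Suc i < R then (\<rho> v, Suc i, K' v, [])
        else (\<rho> v @ [K' v = {}], 0, first_suspects M (inp v) (\<rho> v @ [K' v = {}]), [])))"
    if K: "suspect_inv w V E F bad ?X i K" "\<forall>v\<in>V. st (r + i * B) v = (\<rho> v, i, K v, [])"
      and i: "i < R" for i K
  proof -
    have "r + Suc i * B = r + i * B + Suc (R * w)" by (simp add: B_def)
    moreover have "st (r + i * B) v = (\<rho> v, i, K v, [])" if "v \<in> V" for v
      using K(2) that by blast
    note suspects_exchanged[OF this alive b(1) K(1) i[unfolded R_def]]
    ultimately show ?thesis by (simp only: R_def)
  qed
  have "\<exists>K. suspect_inv w V E F bad ?X i K \<and> (\<forall>v\<in>V. st (r + i * B) v = (\<rho> v, i, K v, []))"
    if "i < R" for i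
    using that
  proof (induction i)
    case 0
    show ?case
      by (rule exI[of _ "\<lambda>v. if ?X v then {} else UNIV"])
        (use suspect_inv_0 in \<open>auto simp: b first_suspects_def\<close>)
  next
    case (Suc i)
    then obtain K where K: "suspect_inv w V E F bad ?X i K"
      "\<forall>v\<in>V. st (r + i * B) v = (\<rho> v, i, K v, [])" by auto
    show ?case using exchange[OF K] Suc.prems by auto
  qed
  \<comment> \<open>The last exchange is treated apart, since it records the outcome and starts the
    next slot.\<close>
  moreover have R: "R - 1 < R" "Suc (R - 1) = R" by (auto simp: R_def radius_def)
  ultimately obtain K where K: "suspect_inv w V E F bad ?X (R - 1) K"
    "\<forall>v\<in>V. st (r + (R - 1) * B) v = (\<rho> v, R - 1, K v, [])" by blast
  from exchange[OF K R(1)] obtain K' where K': "suspect_inv w V E F bad ?X R K'"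
    "\<forall>v\<in>V. st (r + R * B) v =
        (\<rho> v @ [K' v = {}], 0, first_suspects M (inp v) (\<rho> v @ [K' v = {}]), [])"
    unfolding R(2) by auto
  have "slot_length w M n = R * B" by (simp add: slot_length_def R_def B_def)
  then show ?thesis
    using K' b(1) slot_spec_if_suspect_inv[OF K'(1)] unfolding boundary_def R_def
    by (intro exI[of _ "\<lambda>v. K' v = {}"]) auto
qed

lemma verdict_within_guess:
  assumes "v \<in> V" "length \<rho> mod slots M \<noteq> 0"
  shows "verdict M (inp v) \<rho> = None"
  using assms incident by (simp add: verdict_def)

lemma slots_run:
  assumes \<rho>: "boundary r (g * slots M) \<rho>"
    and alive: "\<And>v. v \<in> V \<Longrightarrow> verdict M (inp v) (\<rho> v) = None"
    and "q \<le> slots M"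
  shows "\<exists>c. boundary (r + (\<Sum>k<q. slot_length w M (g * slots M + k))) (g * slots M + q)
        (\<lambda>v. \<rho> v @ map (c v) [0..<q]) \<and>
      (\<forall>k<q. slot_spec V E F (radius M (g * slots M + k))
        (\<lambda>v. starts M (inp v) (\<rho> v @ map (c v) [0..<k])) (\<lambda>v. c v k))"
  using assms(3)
proof (induction q)
  case (Suc q)
  let ?Q = "slots M"
  from Suc obtain c where c: "boundary (r + (\<Sum>k<q. slot_length w M (g * ?Q + k))) (g * ?Q + q)
        (\<lambda>v. \<rho> v @ map (c v) [0..<q])"
      "\<forall>k<q. slot_spec V E F (radius M (g * ?Q + k))
        (\<lambda>v. starts M (inp v) (\<rho> v @ map (c v) [0..<k])) (\<lambda>v. c v k)" by auto
  have "verdict M (inp v) (\<rho> v @ map (c v) [0..<q]) = None" if v: "v \<in> V" for v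
  proof (cases "q = 0")
    case False
    have "length (\<rho> v) = g * ?Q" using \<rho> v by (simp add: boundary_def)
    then show ?thesis using False Suc.prems by (intro verdict_within_guess[OF v]) simp
  qed (simp add: alive v)
  from slot_run[OF c(1) this] obtain cert where cert:
    "boundary (r + (\<Sum>k<q. slot_length w M (g * ?Q + k)) + slot_length w M (g * ?Q + q))
       (Suc (g * ?Q + q)) (\<lambda>v. (\<rho> v @ map (c v) [0..<q]) @ [cert v])"
    "slot_spec V E F (radius M (g * ?Q + q))
       (\<lambda>v. starts M (inp v) (\<rho> v @ map (c v) [0..<q])) cert" by blast
  \<comment> \<open>Earlier outcomes stay as they are, so the starters of earlier slots do not
    change.\<close>
  define c' where "c' v = (c v)(q := cert v)" for v
  have c': "map (c' v) [0..<k] = map (c v) [0..<k]" if "k \<le> q" for v k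
    using that by (auto simp: c'_def)
  show ?case
  proof (intro exI[of _ c'] conjI allI impI)
    have "(\<rho> v @ map (c v) [0..<q]) @ [cert v] = \<rho> v @ map (c' v) [0..<Suc q]" for v
      using c'[of q v] by (simp add: c'_def)
    with cert(1) show "boundary (r + (\<Sum>k<Suc q. slot_length w M (g * ?Q + k))) (g * ?Q + Suc q)
        (\<lambda>v. \<rho> v @ map (c' v) [0..<Suc q])" by (simp add: add.assoc del: upt_Suc)
    fix k assume "k < Suc q"
    then have "k < q \<or> k = q" by auto
    then show "slot_spec V E F (radius M (g * ?Q + k))
        (\<lambda>v. starts M (inp v) (\<rho> v @ map (c' v) [0..<k])) (\<lambda>v. c' v k)"
    proof
      assume "k < q"
      then show ?thesis using c(2) c'[of k] by (simp add: c'_def)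
    next
      assume "k = q"
      then show ?thesis using cert(2) c'[of q] by (simp add: c'_def)
    qed
  qed
qed (use \<rho> in simp)

section \<open>Guesses of the diameter\<close>

lemma starts_within_guess:
  assumes "length \<rho> = g * slots M" "q < slots M"
  shows "starts M (inp v) (\<rho> @ map c [0..<q]) \<longleftrightarrow>
    (if q < 2 * M then v = s \<and> pad M (source_msg G) ! (q div 2) = even q
     else if q = 2 * M then \<not> (\<forall>p<M. c (2 * p) \<or> c (Suc (2 * p)))
     else v = s \<and> \<not> c (2 * M))"
proof -
  have "q = 2 * M \<or> q = Suc (2 * M)" if "\<not> q < 2 * M" using assms(2) that by (auto simp: slots_def)
  then show ?thesis using assms by (auto simp: starts_def informed_def Let_def)
qed

text \<open>At most one edge has code \<open>f\<close> and at most one is faulty, so safe walks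
  avoid at most two edges and \<open>short_walk_avoiding\<close> applies.\<close>

lemma safe_walk:
  assumes "U \<subseteq> V" "U \<noteq> {}" "\<And>v. v \<in> V - U \<Longrightarrow> \<exists>j\<le>R. (s, v) \<in> adj E ^^ j"
    and "10 * R + 5 \<le> R'"
  shows "\<exists>u\<in>U. \<exists>j\<le>R'. (s, u) \<in> safe_adj E F f ^^ j"
proof -
  let ?S = "{{u, v} | u v. edge_code u v = f}"
  let ?X = "F \<union> E \<inter> ?S"
  have same: "x = y" if xy: "x \<in> ?S" "y \<in> ?S" for x y
  proof -
    obtain u v u' v' where "x = {u, v}" "edge_code u v = f" "y = {u', v'}" "edge_code u' v' = f"
      using xy by blast
    then show ?thesis using edge_code_eq_iff[of u v u' v'] by simp
  qed
  have "card (E \<inter> ?S) \<le> 1"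
  proof (cases "E \<inter> ?S = {}")
    case False
    then obtain e where "e \<in> E \<inter> ?S" by blast
    then have "E \<inter> ?S = {e}" using same by blast
    then show ?thesis by simp
  qed simp
  then have "card ?X \<le> 2" using faulty(2) card_Un_le[of F "E \<inter> ?S"] by linarith
  moreover have "?X \<subseteq> E" using faulty(1) by auto
  moreover have "safe_adj E F f = adj (E - ?X)"
    by (auto simp: safe_adj_def adj_def)
  ultimately show ?thesis
    using short_walk_avoiding[OF graph _ _ assms(1,2) source assms(3), of ?X] assms(4)
    by (metis order_trans)
qed

lemma sum_lessThan_add: "(\<Sum>k<a + b. h k) = (\<Sum>k<a. h k) + (\<Sum>k<b. h (a + k))"
  for h :: "nat \<Rightarrow> nat"
  by (induction b) auto

definition time :: "nat \<Rightarrow> nat" where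
  "time n = (\<Sum>k<n. slot_length w M k)"

lemma walk_rev_safe: "(x, y) \<in> safe_adj E F f ^^ j \<Longrightarrow> (y, x) \<in> safe_adj E F f ^^ j"
  unfolding safe_adj_def by (rule adj_relpow_sym)

text \<open>The uninformed nodes serve as \<open>U\<close> in \<open>safe_walk\<close>, since all
  others are certain of some token and thus near the source. Hence the source hears the alarm
  exactly if somebody misses a bit, and all nodes stop or go on together.\<close>

lemma guess_run:
  assumes \<rho>: "boundary (time (g * slots M)) (g * slots M) \<rho>"
    and alive: "\<And>v. v \<in> V \<Longrightarrow> verdict M (inp v) (\<rho> v) = None"
  shows "(\<forall>v\<in>V. output_after P G F A (time (Suc g * slots M)) v = Some (source_msg G, 2 ^ g)) \<and>
        (\<forall>v\<in>V. \<exists>j\<le>15 * 2 ^ g. (s, v) \<in> adj E ^^ j) \<or>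
      (\<exists>v\<in>V. \<forall>j\<le>2 ^ g. (s, v) \<notin> adj E ^^ j) \<and>
        (\<exists>\<rho>'. boundary (time (Suc g * slots M)) (Suc g * slots M) \<rho>' \<and>
           (\<forall>v\<in>V. verdict M (inp v) (\<rho>' v) = None))"
proof -
  note upt_Suc [simp del]
  let ?Q = "slots M"
  let ?T = "time (Suc g * ?Q)"
  let ?x = "pad M (source_msg G)"
  have Q: "?Q > 0" "2 * M < ?Q" "Suc (2 * M) < ?Q" "?Q = Suc (Suc (2 * M))" by (auto simp: slots_def)
  obtain c where c: "boundary (time (g * ?Q) + (\<Sum>k<?Q. slot_length w M (g * ?Q + k))) (g * ?Q + ?Q)
        (\<lambda>v. \<rho> v @ map (c v) [0..<?Q])"
      "\<And>k. k < ?Q \<Longrightarrow> slot_spec V E F (radius M (g * ?Q + k))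
        (\<lambda>v. starts M (inp v) (\<rho> v @ map (c v) [0..<k])) (\<lambda>v. c v k)"
    using slots_run[OF \<rho> alive order_refl] by blast
  have "time (g * ?Q) + (\<Sum>k<?Q. slot_length w M (g * ?Q + k)) = ?T"
    unfolding time_def by (simp add: sum_lessThan_add add.commute[of ?Q])
  with c(1) have end_boundary: "boundary ?T (Suc g * ?Q) (\<lambda>v. \<rho> v @ map (c v) [0..<?Q])"
    by (simp add: add.commute)
  have len: "length (\<rho> v) = g * ?Q" if "v \<in> V" for v using \<rho> that by (simp add: boundary_def)
  define inf where "inf v \<longleftrightarrow> (\<forall>p<M. c v (2 * p) \<or> c v (Suc (2 * p)))" for v
  have rad: "radius M (g * ?Q + k) = (if k < 2 * M then 15 else 155) * 2 ^ g" if "k < ?Q" for k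
    using that by (simp add: radius_def)
  have sound: "\<exists>x\<in>V. starts M (inp x) (\<rho> x @ map (c x) [0..<k]) \<and>
      (\<exists>j\<le>(if k < 2 * M then 15 else 155) * 2 ^ g. (x, v) \<in> adj E ^^ j)"
    if "k < ?Q" "v \<in> V" "c v k" for k v
    using c(2)[OF that(1)] that(2,3) unfolding slot_spec_def rad[OF that(1)] by blast
  have complete: "c v k"
    if "k < ?Q" "v \<in> V" "\<And>f. \<exists>x\<in>V. starts M (inp x) (\<rho> x @ map (c x) [0..<k]) \<and>
      (\<exists>j\<le>(if k < 2 * M then 15 else 155) * 2 ^ g. (x, v) \<in> safe_adj E F f ^^ j)" for k v
    using c(2)[OF that(1)] that(2,3) unfolding slot_spec_def rad[OF that(1)] by blast
  note starts = starts_within_guess[OF len]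
  \<comment> \<open>Only the source starts these tokens, so being certain of one reveals a true bit
    and bounds the distance to the source.\<close>
  have data: "v \<in> V \<Longrightarrow> c v k \<Longrightarrow> ?x ! (k div 2) = even k \<and> (\<exists>j\<le>15 * 2 ^ g. (s, v) \<in> adj E ^^ j)"
    if "k < 2 * M" for k v
    using sound[of k v] that Q by (auto simp: starts)
  have decode: "map (\<lambda>p. c v (2 * p)) [0..<M] = ?x" if "v \<in> V" "inf v" for v
  proof (rule nth_equalityI)
    show "length (map (\<lambda>p. c v (2 * p)) [0..<M]) = length ?x"
      using msg_length by (simp add: length_pad)
    fix p assume "p < length (map (\<lambda>p. c v (2 * p)) [0..<M])"
    then have p: "p < M" by simp
    then have "c v (2 * p) \<or> c v (Suc (2 * p))" using that(2) by (simp add: inf_def)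
    moreover have "c v (2 * p) \<Longrightarrow> ?x ! p" using data[of "2 * p" v] that(1) p by simp
    moreover have "c v (Suc (2 * p)) \<Longrightarrow> \<not> ?x ! p" using data[of "Suc (2 * p)" v] that(1) p by simp
    ultimately show "map (\<lambda>p. c v (2 * p)) [0..<M] ! p = ?x ! p" using p by auto
  qed
  have M: "M > 0" using msg_length by simp
  have near: "\<exists>j\<le>15 * 2 ^ g. (s, v) \<in> adj E ^^ j" if "v \<in> V" "inf v" for v
    using that data[of 0 v] data[of "Suc 0" v] M by (auto simp: inf_def dest: spec[of _ 0])
  have alarm: "c s (2 * M) \<longleftrightarrow> (\<exists>v\<in>V. \<not> inf v)"
  proof
    assume "c s (2 * M)"
    then show "\<exists>v\<in>V. \<not> inf v"
      using sound[of "2 * M" s] Q source by (auto simp: starts inf_def)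
  next
    assume "\<exists>v\<in>V. \<not> inf v"
    then have U: "{v \<in> V. \<not> inf v} \<noteq> {}" by blast
    \<comment> \<open>The walk leads from the source to an uninformed node; reversed, it brings the
      alarm to the source.\<close>
    have "\<exists>u\<in>{v \<in> V. \<not> inf v}. \<exists>j\<le>155 * 2 ^ g. (s, u) \<in> safe_adj E F f ^^ j" for f
      by (rule safe_walk[where R = "15 * 2 ^ g", OF _ U]) (use near in auto)
    then show "c s (2 * M)"
      using Q source by (intro complete) (auto simp: starts inf_def, metis walk_rev_safe)
  qed
  have fin: "c v (Suc (2 * M)) \<longleftrightarrow> (\<forall>v\<in>V. inf v)" if v: "v \<in> V" for v
  proof
    assume "c v (Suc (2 * M))"
    then show "\<forall>v\<in>V. inf v"
      using sound[of "Suc (2 * M)" v] Q v alarm by (auto simp: starts)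
  next
    assume all: "\<forall>v\<in>V. inf v"
    have "\<exists>u\<in>{v}. \<exists>j\<le>155 * 2 ^ g. (s, u) \<in> safe_adj E F f ^^ j" for f
      by (rule safe_walk[where R = "15 * 2 ^ g"]) (use v near all in auto)
    then show "c v (Suc (2 * M))"
      using Q source v all alarm by (intro complete) (auto simp: starts)
  qed
  have verdict_end: "verdict M (inp v) (\<rho> v @ map (c v) [0..<?Q]) =
      (if \<forall>v\<in>V. inf v then Some (source_msg G, 2 ^ g) else None)" if v: "v \<in> V" for v
  proof -
    have "last (map (c v) [0..<?Q]) = c v (Suc (2 * M))" using Q(4) by (simp add: upt_Suc)
    then have last: "last (\<rho> v @ map (c v) [0..<?Q]) \<longleftrightarrow> (\<forall>v\<in>V. inf v)"
      using fin[OF v] Q(1) by (simp add: last_append)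
    have "map (\<lambda>p. map (c v) [0..<?Q] ! (2 * p)) [0..<M] = map (\<lambda>p. c v (2 * p)) [0..<M]"
      using Q(4) by auto
    then have "unpad (map (\<lambda>p. map (c v) [0..<?Q] ! (2 * p)) [0..<M]) = source_msg G"
      if "\<forall>v\<in>V. inf v" using that decode[OF v] v by (simp only: unpad_pad)
    then show ?thesis
      using last incident[OF v] len[OF v] Q(1) by (auto simp: verdict_def Let_def)
  qed
  show ?thesis
  proof (cases "\<forall>v\<in>V. inf v")
    case True
    have "output_after P G F A ?T v = Some (source_msg G, 2 ^ g)" if v: "v \<in> V" for v
    proof -
      have "fst (st ?T v) = \<rho> v @ map (c v) [0..<?Q]"
        using end_boundary v by (simp add: boundary_def)
      then show ?thesis using verdict_end[OF v] True by (simp add: output_after_def result_eq)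
    qed
    then show ?thesis using near True by blast
  next
    case False
    \<comment> \<open>If everybody were within \<open>2 ^ g\<close>, the tokens of all true bits
      would reach every node, and nobody would be uninformed.\<close>
    have "\<exists>v\<in>V. \<forall>j\<le>2 ^ g. (s, v) \<notin> adj E ^^ j"
    proof (rule ccontr)
      assume "\<not> ?thesis"
      then have close: "\<exists>j\<le>2 ^ g. (s, v) \<in> adj E ^^ j" if "v \<in> V" for v using that by blast
      have "c v k" if k: "k < 2 * M" "?x ! (k div 2) = even k" and v: "v \<in> V" for v k
      proof -
        have "(10::nat) * 2 ^ g + 5 \<le> 15 * 2 ^ g" using one_le_power[of "2::nat" g] by linarith
        then have "\<exists>u\<in>{v}. \<exists>j\<le>15 * 2 ^ g. (s, u) \<in> safe_adj E F f ^^ j" for f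
          by (intro safe_walk[where R = "2 ^ g"]) (use v close in auto)
        then show ?thesis using Q source k v by (intro complete) (auto simp: starts)
      qed
      note cert = this
      have "inf v" if v: "v \<in> V" for v
        unfolding inf_def
      proof (intro allI impI)
        fix p assume "p < M"
        then show "c v (2 * p) \<or> c v (Suc (2 * p))"
          using cert[of "2 * p", OF _ _ v] cert[of "Suc (2 * p)", OF _ _ v] by (cases "?x ! p") auto
      qed
      with False show False by blast
    qed
    moreover have "\<forall>v\<in>V. verdict M (inp v) (\<rho> v @ map (c v) [0..<?Q]) = None"
      using verdict_end False by simp
    ultimately show ?thesis using end_boundary by blast
  qed
qed

text \<open>A failing guess exhibits a node further than \<open>2 ^ g\<close> from the source, so
  \<open>2 ^ g < D\<close> and the next guess is at most \<open>2 * D\<close>. A successful one puts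
  all nodes within \<open>15 * 2 ^ g\<close> of the source, whence the factor 30.\<close>

lemma guess_exists:
  assumes far: "\<And>R. (\<And>v. v \<in> V \<Longrightarrow> \<exists>j\<le>R. (s, v) \<in> adj E ^^ j) \<Longrightarrow> D \<le> 2 * R"
    and close: "\<And>v. v \<in> V \<Longrightarrow> \<exists>j\<le>D. (s, v) \<in> adj E ^^ j"
    and "D > 0"
  shows "\<exists>g. (\<forall>v\<in>V. output_after P G F A (time (Suc g * slots M)) v = Some (source_msg G, 2 ^ g)) \<and>
    D \<le> 30 * 2 ^ g \<and> 2 ^ g \<le> 2 * D"
proof (rule ccontr)
  assume none: "\<not> ?thesis"
  have running: "\<exists>\<rho>. boundary (time (g * slots M)) (g * slots M) \<rho> \<and>
      (\<forall>v\<in>V. verdict M (inp v) (\<rho> v) = None) \<and> 2 ^ g \<le> 2 * D" for g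
  proof (induction g)
    case 0
    have "boundary 0 0 (\<lambda>v. [])" by (simp add: boundary_def st_0)
    then show ?case
      using incident \<open>D > 0\<close> by (intro exI[of _ "\<lambda>v. []"]) (simp add: time_def verdict_def)
  next
    case (Suc g)
    then obtain \<rho> where \<rho>: "boundary (time (g * slots M)) (g * slots M) \<rho>"
      "\<And>v. v \<in> V \<Longrightarrow> verdict M (inp v) (\<rho> v) = None" "2 ^ g \<le> 2 * D" by auto
    have "\<not> (\<forall>v\<in>V. output_after P G F A (time (Suc g * slots M)) v = Some (source_msg G, 2 ^ g)) \<or>
        \<not> (\<forall>v\<in>V. \<exists>j\<le>15 * 2 ^ g. (s, v) \<in> adj E ^^ j)"
      using none \<rho>(3) far[of "15 * 2 ^ g"] by auto
    then obtain v \<rho>' where v: "v \<in> V" "\<forall>j\<le>2 ^ g. (s, v) \<notin> adj E ^^ j" and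
      \<rho>': "boundary (time (Suc g * slots M)) (Suc g * slots M) \<rho>'"
        "\<forall>v\<in>V. verdict M (inp v) (\<rho>' v) = None"
      using guess_run[OF \<rho>(1,2)] by blast
    have "2 ^ g < D" using close[OF v(1)] v(2) by (meson not_le order_trans)
    then show ?case using \<rho>' by (intro exI[of _ \<rho>']) simp
  qed
  have "2 ^ Suc D \<le> 2 * D" using running[of "Suc D"] by blast
  then show False using less_exp[of D] by simp
qed

text \<open>A slot is quadratic in its radius, so the guesses form a geometric series of ratio 4,
  dominated by its last term.\<close>

lemma time_le: "time (g * slots M) \<le> slots M * (155\<^sup>2 * Suc w) * 4 ^ g"
proof (induction g)
  case (Suc g)
  have len: "slot_length w M (g * slots M + k) \<le> 155\<^sup>2 * Suc w * 4 ^ g" if "k < slots M" for k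
  proof -
    define R where "R = radius M (g * slots M + k)"
    have R: "R \<le> 155 * 2 ^ g" "1 \<le> R" using that by (auto simp: R_def radius_def)
    have "slot_length w M (g * slots M + k) = R + R * R * w"
      by (simp add: slot_length_def R_def algebra_simps)
    also have "\<dots> \<le> R * R + R * R * w" using R(2) by simp
    also have "\<dots> = R\<^sup>2 * Suc w" by (simp add: power2_eq_square)
    also have "\<dots> \<le> (155 * 2 ^ g)\<^sup>2 * Suc w" using R(1) by (intro mult_le_mono1 power_mono) auto
    also have "\<dots> = 155\<^sup>2 * Suc w * 4 ^ g"
    proof -
      have "(2 ^ g)\<^sup>2 = (4::nat) ^ g" by (simp add: power2_eq_square flip: power_mult_distrib)
      then show ?thesis unfolding power_mult_distrib by (simp only: mult_ac)
    qed
    finally show ?thesis .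
  qed
  have "time (Suc g * slots M) =
      time (g * slots M) + (\<Sum>k<slots M. slot_length w M (g * slots M + k))"
    by (simp add: time_def sum_lessThan_add add.commute[of "slots M"])
  also have "\<dots> \<le> slots M * (155\<^sup>2 * Suc w) * 4 ^ g + slots M * (155\<^sup>2 * Suc w * 4 ^ g)"
    using sum_bounded_above[of "{..<slots M}", OF len] by (intro add_mono Suc.IH) simp
  also have "\<dots> \<le> slots M * (155\<^sup>2 * Suc w) * 4 ^ Suc g" by simp
  finally show ?case .
qed (simp add: time_def)

end

section \<open>Round complexity\<close>

definition size_bits :: "nat \<Rightarrow> nat" where
  "size_bits e = nat \<lceil>log 2 (real e + 1)\<rceil>"

lemma less_size_bits: "e < 2 ^ size_bits e"
proof -
  have "real e + 1 = 2 powr log 2 (real e + 1)" by simp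
  also have "\<dots> \<le> 2 powr real (size_bits e)"
    unfolding size_bits_def by (intro powr_mono) linarith+
  also have "\<dots> = real (2 ^ size_bits e)" by (simp add: powr_realpow)
  finally show ?thesis by linarith
qed

lemma size_bits_le:
  assumes "e \<le> n ^ b" "n \<ge> 2"
  shows "real (size_bits e) \<le> real (b + 2) * log 2 (real n)"
proof -
  have log: "1 \<le> log 2 (real n)" using assms(2) by simp
  have "real e \<le> real n ^ b" using assms(1) by (metis of_nat_le_iff of_nat_power)
  moreover have "1 \<le> real n ^ b" using assms(2) by simp
  ultimately have "real e + 1 \<le> 2 * real n ^ b" by linarith
  then have "log 2 (real e + 1) \<le> log 2 (2 * real n ^ b)" by (intro log_mono) auto
  also have "\<dots> = 1 + real b * log 2 (real n)" using assms(2) by (simp add: log_mult log_nat_power)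
  finally have "log 2 (real e + 1) \<le> 1 + real b * log 2 (real n)" .
  moreover have "0 \<le> log 2 (real e + 1)" by simp
  ultimately have "real (size_bits e) \<le> 2 + real b * log 2 (real n)"
    unfolding size_bits_def by linarith
  also have "\<dots> \<le> real (b + 2) * log 2 (real n)" using log by (simp add: algebra_simps)
  finally show ?thesis .
qed

text \<open>The nodes know only the estimate. This bound makes the padded length computed from it
  large enough, while \<open>size_bits_le\<close> keeps it logarithmic.\<close>

lemma log_le_size_bits:
  assumes "n \<le> e ^ b" "n \<ge> 2"
  shows "log 2 (real n) \<le> b * size_bits e"
proof -
  have "n \<le> (2 ^ size_bits e) ^ b"
    using assms(1) less_size_bits[of e] by (meson less_imp_le le_trans power_mono zero_le)
  also have "\<dots> = 2 ^ (b * size_bits e)" by (simp add: power_mult[symmetric] mult.commute)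
  finally have "real n \<le> 2 ^ (b * size_bits e)" by (metis of_nat_le_iff of_nat_numeral of_nat_power)
  then have "log 2 (real n) \<le> log 2 (2 ^ (b * size_bits e))" using assms(2) by (intro log_mono) auto
  then show ?thesis by (simp add: log_pow_cancel)
qed

section \<open>Connectivity and diameter\<close>

lemma edge_connected_connected:
  assumes "edge_connected k V E" "k > 0"
  shows "connected_graph V E"
  using assms(1)[unfolded edge_connected_def, rule_format, of "{}"] assms(2) by simp

lemma incident_edges_nonempty:
  assumes "edge_connected 3 V E" "v \<in> V" "card V \<ge> 2"
  shows "{e \<in> E. v \<in> e} \<noteq> {}"
proof -
  have "V \<noteq> {v}" using assms(3) by auto
  then obtain u where u: "u \<in> V" "u \<noteq> v" using assms(2) by blast
  have "connected_graph V E" using edge_connected_connected[OF assms(1)] by simp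
  then have "(v, u) \<in> (adj E)\<^sup>*" using u assms(2) by (simp add: connected_graph_def)
  then obtain x where "(v, x) \<in> adj E" using u(2) by (metis converse_rtranclE)
  then show ?thesis by (auto simp: adj_def)
qed

lemma graph_dist_le: "(u, v) \<in> adj E ^^ j \<Longrightarrow> graph_dist E u v \<le> j"
  unfolding graph_dist_def by (rule Least_le)

lemma graph_diameter_le:
  assumes "finite V" "V \<noteq> {}" "\<And>u v. u \<in> V \<Longrightarrow> v \<in> V \<Longrightarrow> graph_dist E u v \<le> R"
  shows "graph_diameter V E \<le> R"
proof -
  have "{graph_dist E u v | u v. u \<in> V \<and> v \<in> V} = (\<lambda>(u, v). graph_dist E u v) ` (V \<times> V)" by auto
  then have "finite {graph_dist E u v | u v. u \<in> V \<and> v \<in> V}" using assms(1) by simp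
  then show ?thesis
    unfolding graph_diameter_def by (rule Max.boundedI) (use assms(2,3) in blast)+
qed

lemma walk_of_diameter:
  assumes "finite V" "connected_graph V E" "u \<in> V" "v \<in> V"
  shows "\<exists>j\<le>graph_diameter V E. (u, v) \<in> adj E ^^ j"
proof -
  have "{graph_dist E u v | u v. u \<in> V \<and> v \<in> V} = (\<lambda>(u, v). graph_dist E u v) ` (V \<times> V)" by auto
  then have "finite {graph_dist E u v | u v. u \<in> V \<and> v \<in> V}" using assms(1) by simp
  then have "graph_dist E u v \<le> graph_diameter V E"
    unfolding graph_diameter_def by (rule Max_ge) (use assms(3,4) in blast)
  moreover have "(u, v) \<in> (adj E)\<^sup>*" using assms(2-4) by (simp add: connected_graph_def)
  then obtain k where "(u, v) \<in> adj E ^^ k" using rtrancl_imp_relpow by blast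
  then have "(u, v) \<in> adj E ^^ graph_dist E u v" unfolding graph_dist_def by (rule LeastI)
  ultimately show ?thesis by (intro exI conjI)
qed

lemma graph_diameter_le_radius:
  assumes "finite V" "s \<in> V" "\<And>v. v \<in> V \<Longrightarrow> \<exists>j\<le>R. (s, v) \<in> adj E ^^ j"
  shows "graph_diameter V E \<le> 2 * R"
proof (rule graph_diameter_le)
  fix u v assume "u \<in> V" "v \<in> V"
  then obtain i j where ij: "i \<le> R" "(s, u) \<in> adj E ^^ i" "j \<le> R" "(s, v) \<in> adj E ^^ j"
    using assms(3) by meson
  then have "(u, v) \<in> adj E ^^ (i + j)"
    using adj_relpow_sym[OF ij(2)] by (auto simp: relpow_add)
  then have "graph_dist E u v \<le> i + j" by (rule graph_dist_le)
  then show "graph_dist E u v \<le> 2 * R" using ij(1,3) by linarith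
qed (use assms in auto)

lemma graph_diameter_pos:
  assumes "finite V" "connected_graph V E" "card V \<ge> 2"
  shows "graph_diameter V E > 0"
proof (rule ccontr)
  assume "\<not> ?thesis"
  then have "\<forall>u\<in>V. \<forall>v\<in>V. u = v"
    using walk_of_diameter[OF assms(1,2)] by (intro ballI) fastforce
  then have "card V \<le> Suc 0" by (simp only: card_le_Suc0_iff_eq[OF assms(1)])
  then show False using assms(3) by simp
qed

text \<open>Every message is a single bit, and a graph with an edge has at least two nodes, so its
  \<open>log_size\<close> is at least 1.\<close>

lemma sent_bounded:
  assumes "simple_graph (nodes G) (edges G)"
  shows "traffic_bounded (1 * log_size G) (sent (broadcast wd len) G c)"
  unfolding traffic_bounded_def
proof (intro allI impI)
  fix u v m assume sent: "sent (broadcast wd len) G c u v = Some m"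
  then have "{u, v} \<in> edges G" by (auto simp: sent_def split: if_splits)
  then obtain x y where xy: "x \<in> nodes G" "y \<in> nodes G" "x \<noteq> y"
    using assms unfolding simple_graph_def by meson
  have "card {x, y} \<le> card (nodes G)"
    using assms xy by (intro card_mono) (auto simp: simple_graph_def)
  then have "1 \<le> log 2 (real (card (nodes G)))" using xy(3) by simp
  moreover have "length m = 1"
    using sent by (auto simp: sent_def broadcast_def split: if_splits prod.splits)
  ultimately show "real (length m) \<le> 1 * log_size G" by simp
qed

text \<open>Identifiers fit into \<open>a * b * size_bits e\<close> bits, so
  \<open>edge_code_less\<close> dictates \<open>wd\<close>; the extra bit in \<open>len\<close> is
  the marker of \<open>pad\<close>.\<close>

lemma broadcast_correct:
  fixes a b c :: nat
  defines "wd \<equiv> \<lambda>e. 2 * (a * b * size_bits e) + 3" and "len \<equiv> \<lambda>e. Suc (c * b * size_bits e)"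
  assumes valid: "valid_network a b c G" "edge_connected 3 (nodes G) (edges G)"
    and adversary: "F \<subseteq> edges G" "card F \<le> 1"
    and D: "D = graph_diameter (nodes G) (edges G)"
  shows "\<exists>T. real T \<le> 16 * 155\<^sup>2 * real (4 + 2 * (c * b) * (b + 2)) *
      real (4 + 2 * (a * b) * (b + 2)) * (real D)\<^sup>2 * log_size G ^ 2 \<and>
    (\<forall>v\<in>nodes G. \<exists>d. output_after (broadcast wd len) G F A T v = Some (source_msg G, d) \<and>
      real D \<le> 30 * real d \<and> real d \<le> 30 * real D)"
proof -
  let ?V = "nodes G" and ?E = "edges G" and ?e = "estimate G"
  let ?n = "card ?V" and ?l = "size_bits ?e"
  have G: "simple_graph ?V ?E" "source G \<in> ?V" "\<And>v. v \<in> ?V \<Longrightarrow> v < ?n ^ a"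
    "?e \<le> ?n ^ b" "?n \<le> ?e ^ b" "real (length (source_msg G)) \<le> real c * log_size G"
    using valid(1) by (auto simp: valid_network_def)
  have finV: "finite ?V" using G(1) by (simp add: simple_graph_def)
  have conn: "connected_graph ?V ?E"
    using edge_connected_connected[OF valid(2)] by simp
  show ?thesis
  proof (cases "?n \<ge> 2")
    case False
    then have "?n = 1" using G(2) finV by (metis One_nat_def Suc_1 card_gt_0_iff empty_iff
      less_Suc_eq not_le not_less_eq)
    then have V: "?V = {source G}" using G(2) by (metis card_1_singletonE singletonD)
    then have "?E = {}" using G(1) by (auto simp: simple_graph_def)
    moreover have "D = 0"
      using graph_diameter_le_radius[OF finV G(2), of 0 ?E] V D by simp
    \<comment> \<open>The time bound is 0 here, and the lone node answers before the first
      round.\<close>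
    ultimately show ?thesis using V
      by (intro exI[of _ 0])
        (simp add: output_after_def broadcast_def verdict_def local_input_of_def)
  next
    case n: True
    obtain bad where bad: "\<And>u v. {u, v} \<in> F \<Longrightarrow> edge_code u v = bad"
    proof (cases "\<exists>x y. {x, y} \<in> F")
      case True
      then obtain x y where xy: "{x, y} \<in> F" by blast
      have "?E \<subseteq> Pow ?V" using G(1) by (auto simp: simple_graph_def)
      then have "finite ?E" using finV finite_subset[of ?E "Pow ?V"] by simp
      then have "finite F" by (rule finite_subset[OF adversary(1)])
      then have same: "\<forall>e\<in>F. \<forall>e'\<in>F. e = e'" using adversary(2) card_le_Suc0_iff_eq[of F] by simp
      have "{u, v} \<in> F \<Longrightarrow> edge_code u v = edge_code x y" for u v
        using same[THEN bspec, THEN bspec, OF _ xy] by (simp add: edge_code_eq_iff)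
      then show ?thesis by (rule that)
    next
      case False
      then show ?thesis using that[of 0] by blast
    qed
    have id: "v < 2 ^ (a * b * ?l)" if "v \<in> ?V" for v
    proof -
      have "?n \<le> (2 ^ ?l) ^ b"
        using G(5) less_size_bits[of ?e] by (meson less_imp_le le_trans power_mono zero_le)
      then have "?n ^ a \<le> ((2 ^ ?l) ^ b) ^ a" by (intro power_mono) auto
      also have "\<dots> = 2 ^ (a * b * ?l)" by (simp add: power_mult[symmetric] mult.commute mult.left_commute)
      finally show ?thesis using G(3)[OF that] by linarith
    qed
    have "real (length (source_msg G)) \<le> real c * (b * ?l)"
      using G(6) log_le_size_bits[OF G(5) n] by (meson mult_left_mono of_nat_0_le_iff order_trans)
    then have "length (source_msg G) \<le> c * b * ?l"
      by (metis mult.assoc of_nat_le_iff of_nat_mult)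
    then interpret broadcast_run wd len G F A bad
      using G valid(2) adversary bad id edge_code_less incident_edges_nonempty[OF valid(2) _ n]
      by unfold_locales (auto simp: wd_def len_def)
    have D0: "D > 0" using graph_diameter_pos[OF finV conn n] D by simp
    obtain g where g: "\<forall>v\<in>?V. output_after P G F A (time (Suc g * slots M)) v =
        Some (source_msg G, 2 ^ g)" "D \<le> 30 * 2 ^ g" "2 ^ g \<le> 2 * D"
      using guess_exists[OF _ _ D0] graph_diameter_le_radius[OF finV G(2)]
        walk_of_diameter[OF finV conn G(2)] unfolding D by blast
    have log: "1 \<le> log_size G" using n by simp
    have bits: "real ?l \<le> (b + 2) * log_size G" by (rule size_bits_le[OF G(4) n])
    have aff: "real (4 + 2 * k * ?l) \<le> real (4 + 2 * k * (b + 2)) * log_size G" for k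
    proof -
      have "real (2 * k) * real ?l \<le> real (2 * k) * ((b + 2) * log_size G)"
        using bits by (intro mult_left_mono) auto
      then show ?thesis using log by (simp add: algebra_simps)
    qed
    define X where "X = slots M * Suc w"
    \<comment> \<open>The guess that succeeds is at most \<open>2 * D\<close>, which makes the
      exponential in \<open>g\<close> quadratic in \<open>D\<close>.\<close>
    have "(4::nat) ^ Suc g = 4 * (2 ^ g)\<^sup>2"
      by (simp add: power2_eq_square power_mult_distrib[symmetric])
    also have "\<dots> \<le> 4 * (2 * D)\<^sup>2" using g(3) by (intro mult_le_mono2 power_mono) auto
    also have "\<dots> = 16 * D\<^sup>2" by (simp add: power_mult_distrib)
    finally have "slots M * (155\<^sup>2 * Suc w) * 4 ^ Suc g \<le> slots M * (155\<^sup>2 * Suc w) * (16 * D\<^sup>2)"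
      by (rule mult_le_mono2)
    with time_le[of "Suc g"] have "time (Suc g * slots M) \<le> slots M * (155\<^sup>2 * Suc w) * (16 * D\<^sup>2)"
      by (rule order_trans)
    also have "\<dots> = 16 * 155\<^sup>2 * D\<^sup>2 * X" unfolding X_def by (simp only: mult_ac)
    finally have "real (time (Suc g * slots M)) \<le> real (16 * 155\<^sup>2 * D\<^sup>2 * X)"
      by (rule of_nat_mono)
    also have "\<dots> = 16 * 155\<^sup>2 * (real D)\<^sup>2 * (real (slots M) * real (Suc w))"
      unfolding X_def of_nat_mult of_nat_power of_nat_numeral ..
    \<comment> \<open>\<open>slots M\<close> and \<open>Suc w\<close> are affine in the bit size of
      the estimate, so each contributes one logarithm.\<close>
    also have "\<dots> \<le> 16 * 155\<^sup>2 * (real D)\<^sup>2 * ((real (4 + 2 * (c * b) * (b + 2)) * log_size G) *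
        (real (4 + 2 * (a * b) * (b + 2)) * log_size G))"
    proof (intro mult_left_mono mult_mono)
      show "real (slots M) \<le> real (4 + 2 * (c * b) * (b + 2)) * log_size G"
        using aff[of "c * b"] by (simp add: slots_def len_def mult.assoc)
      show "real (Suc w) \<le> real (4 + 2 * (a * b) * (b + 2)) * log_size G"
        using aff[of "a * b"] by (simp add: wd_def mult.assoc)
    qed (use log in auto)
    also have "\<dots> = 16 * 155\<^sup>2 * real (4 + 2 * (c * b) * (b + 2)) *
        real (4 + 2 * (a * b) * (b + 2)) * (real D)\<^sup>2 * log_size G ^ 2"
      unfolding power2_eq_square[of "log_size G"] by (simp only: mult_ac)
    finally have time: "real (time (Suc g * slots M)) \<le> \<dots>" .
    show ?thesis
    proof (intro exI conjI ballI)
      fix v assume "v \<in> ?V"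
      then show "output_after P G F A (time (Suc g * slots M)) v = Some (source_msg G, 2 ^ g)"
        using g(1) by blast
      show "real D \<le> 30 * real (2 ^ g)" using of_nat_mono[OF g(2), where 'a = real] by simp
      show "real (2 ^ g) \<le> 30 * real D" using of_nat_mono[OF g(3), where 'a = real] by simp
    qed (rule time)
  qed
qed

theorem theorem1:
  fixes a b c :: nat
  shows "\<exists>(P :: (msg \<times> nat) protocol) (\<beta> :: real) (C :: real) (k :: nat) (\<alpha> :: real). \<beta> > 0 \<and>
    (\<forall>(G :: network) (F :: nat set set) (A :: adversary) (D :: nat).
      valid_network a b c G \<and> edge_connected 3 (nodes G) (edges G) \<and>
      D = graph_diameter (nodes G) (edges G) \<and> valid_adversary 1 \<beta> G F A \<longrightarrow>
        (\<forall>r. traffic_bounded (\<beta> * log_size G) (sent P G (config_after P G F A r))) \<and>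
        (\<exists>T. real T \<le> C * (real D)\<^sup>2 * log_size G ^ k \<and>
             (\<forall>v\<in>nodes G. \<exists>d. output_after P G F A T v = Some (source_msg G, d) \<and>
                 real D \<le> \<alpha> * real d \<and> real d \<le> \<alpha> * real D)))"
proof -
  let ?P = "broadcast (\<lambda>e. 2 * (a * b * size_bits e) + 3) (\<lambda>e. Suc (c * b * size_bits e))"
  let ?C = "16 * 155\<^sup>2 * real (4 + 2 * (c * b) * (b + 2)) * real (4 + 2 * (a * b) * (b + 2))"
  have main: "(\<forall>r. traffic_bounded (1 * log_size G) (sent ?P G (config_after ?P G F A r))) \<and>
        (\<exists>T. real T \<le> ?C * (real D)\<^sup>2 * log_size G ^ 2 \<and>
             (\<forall>v\<in>nodes G. \<exists>d. output_after ?P G F A T v = Some (source_msg G, d) \<and>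
                 real D \<le> 30 * real d \<and> real d \<le> 30 * real D))"
    if "valid_network a b c G \<and> edge_connected 3 (nodes G) (edges G) \<and>
      D = graph_diameter (nodes G) (edges G) \<and> valid_adversary 1 1 G F A" for G F A D
  proof (intro conjI allI)
    show "traffic_bounded (1 * log_size G) (sent ?P G (config_after ?P G F A r))" for r
      using that by (intro sent_bounded) (simp add: valid_network_def)
    show "\<exists>T. real T \<le> ?C * (real D)\<^sup>2 * log_size G ^ 2 \<and>
             (\<forall>v\<in>nodes G. \<exists>d. output_after ?P G F A T v = Some (source_msg G, d) \<and>
                 real D \<le> 30 * real d \<and> real d \<le> 30 * real D)"
      by (rule broadcast_correct) (use that in \<open>simp_all add: valid_adversary_def\<close>)
  qed
  show ?thesis
    by (rule exI[of _ ?P], rule exI[of _ 1], rule exI[of _ ?C], rule exI[of _ 2], rule exI[of _ 30],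
      rule conjI[OF zero_less_one], intro allI impI, rule main)
qed

end
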